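(* For every $n$, the number of $\alpha\in\mathcal{ODP}_n$ with $f(\alpha)=0$ (i.e. with no fixed point) is $2^{n+1}-(2n+1)$.
   Context: For $n\ge 0$ let $X_n=\{1,2,\dots,n\}$ and let $\mathcal{I}_n$ be the set of all partial injective maps of $X_n$ (including the empty map). $\mathcal{ODP}_n$ is the set of all $\alpha\in\mathcal{I}_n$ such that for all $x,y\in\mathrm{Dom}\,\alpha$, $|x-y|=|x\alpha-y\alpha|$, and $x\le y$ implies $x\alpha\le y\alpha$ (order-preserving partial isometries; $x\alpha$ denotes the image of $x$ under $\alpha$). For $\alpha\in\mathcal{I}_n$, $f(\alpha)=|F(\alpha)|$ where $F(\alpha)=\{x\in\mathrm{Dom}\,\alpha: x\alpha=x\}$. *)

theory Defs
  imports Main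
begin

text \<open>
  A partial map of \<open>{1..n}\<close> is a function \<open>\<alpha> :: nat \<rightharpoonup> nat\<close> with domain and range
  contained in \<open>{1..n}\<close>; the image of \<open>x \<in> dom \<alpha>\<close> is \<open>the (\<alpha> x)\<close>.
\<close>

definition partial_injections :: "nat \<Rightarrow> (nat \<rightharpoonup> nat) set" where
  "partial_injections n =
     {\<alpha>. dom \<alpha> \<subseteq> {1..n} \<and> ran \<alpha> \<subseteq> {1..n} \<and> inj_on \<alpha> (dom \<alpha>)}"

text \<open>Distances are taken in \<open>int\<close> because subtraction on \<open>nat\<close> truncates.\<close>

definition ODP :: "nat \<Rightarrow> (nat \<rightharpoonup> nat) set" where
  "ODP n = {\<alpha> \<in> partial_injections n. \<forall>x\<in>dom \<alpha>. \<forall>y\<in>dom \<alpha>.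
      \<bar>int x - int y\<bar> = \<bar>int (the (\<alpha> x)) - int (the (\<alpha> y))\<bar> \<and>
      (x \<le> y \<longrightarrow> the (\<alpha> x) \<le> the (\<alpha> y))}"

definition fixed_points :: "(nat \<rightharpoonup> nat) \<Rightarrow> nat set" where
  "fixed_points \<alpha> = {x \<in> dom \<alpha>. the (\<alpha> x) = x}"

definition num_fixed_points :: "(nat \<rightharpoonup> nat) \<Rightarrow> nat" where
  "num_fixed_points \<alpha> = card (fixed_points \<alpha>)"

end

theory Submission
  imports Defs
begin

text \<open>
  An order-preserving partial isometry is the restriction of a translation \<open>x \<mapsto> x + c\<close>, and it has
  no fixed point iff it is empty or \<open>c \<noteq> 0\<close>. For \<open>\<bar>c\<bar> = k \<ge> 1\<close> the nonempty restrictions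
  correspond to the nonempty subsets of \<open>{1..n - k}\<close>. Hence the number is
  \<open>1 + 2 * (\<Sum>k = 1..n. 2 ^ (n - k) - 1)\<close>.
\<close>

definition shift_up :: "nat \<Rightarrow> nat set \<Rightarrow> (nat \<rightharpoonup> nat)" where
  "shift_up k A = (\<lambda>x. if x \<in> A then Some (x + k) else None)"

text \<open>Here \<open>A\<close> is the range, so that up- and down-shifts are indexed by the same pairs \<open>(k, A)\<close>.\<close>

definition shift_down :: "nat \<Rightarrow> nat set \<Rightarrow> (nat \<rightharpoonup> nat)" where
  "shift_down k A = (\<lambda>x. if k \<le> x \<and> x - k \<in> A then Some (x - k) else None)"

text \<open>The bound \<open>n - k\<close> keeps both \<open>A\<close> and its translate by
  \<open>k\<close> inside \<open>{1..n}\<close>. The empty set is left out because it yields the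
  empty map for every \<open>k\<close>.\<close>

definition shift_params :: "nat \<Rightarrow> (nat \<times> nat set) set" where
  "shift_params n = (SIGMA k:{1..n}. Pow {1..n - k} - {{}})"

lemma shift_up_eq_Some_iff: "shift_up k A x = Some y \<longleftrightarrow> x \<in> A \<and> y = x + k"
  by (auto simp: shift_up_def)

lemma shift_down_eq_Some_iff: "shift_down k A x = Some y \<longleftrightarrow> y \<in> A \<and> x = y + k"
  by (auto simp: shift_down_def)

lemma dom_shift_up: "dom (shift_up k A) = A"
  by (auto simp: dom_def shift_up_eq_Some_iff)

lemma ran_shift_down: "ran (shift_down k A) = A"
  by (auto simp: ran_def shift_down_eq_Some_iff)

lemma mem_shift_params_iff:
  "(k, A) \<in> shift_params n \<longleftrightarrow> 1 \<le> k \<and> k \<le> n \<and> A \<noteq> {} \<and> A \<subseteq> {1..n - k}"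
  by (auto simp: shift_params_def)

lemma finite_shift_params: "finite (shift_params n)"
  by (auto simp: shift_params_def)

lemma card_shift_params: "int (card (shift_params n)) = 2 ^ n - 1 - int n"
proof -
  have "card (shift_params n) = (\<Sum>k\<in>{1..n}. card (Pow {1..n - k} - {{}}))"
    unfolding shift_params_def by (rule card_SigmaI) auto
  also have "\<dots> = (\<Sum>k\<in>{1..n}. 2 ^ (n - k) - 1)"
    by (intro sum.cong refl) (simp add: card_Diff_singleton card_Pow)
  \<comment> \<open>Substitute m = n - k, which reverses the order of summation.\<close>
  also have "\<dots> = (\<Sum>m<n. 2 ^ m - 1)"
    by (rule sum.reindex_bij_witness[of _ "\<lambda>m. n - m" "\<lambda>k. n - k"]) auto
  \<comment> \<open>Since 1 \<le> 2 ^ m, the truncated subtraction is exact and survives the passage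
    to \<open>int\<close>.\<close>
  finally have "int (card (shift_params n)) = (\<Sum>m<n. 2 ^ m - 1)"
    by (simp add: of_nat_diff)
  also have "\<dots> = 2 ^ n - 1 - int n"
    by (induction n) auto
  finally show ?thesis .
qed

text \<open>The domain of the map recovers \<open>A\<close>; as \<open>A\<close> is nonempty, the
  displacement of any of its points recovers \<open>k\<close>.\<close>

lemma inj_on_shift_up: "inj_on (case_prod shift_up) (shift_params n)"
proof (rule inj_onI, clarify)
  fix k l A B
  assume kA: "(k, A) \<in> shift_params n" and eq: "shift_up k A = shift_up l B"
  have "A = B" using eq by (metis dom_shift_up)
  moreover obtain a where "a \<in> A" using kA by (auto simp: mem_shift_params_iff)
  then have "k = l" using fun_cong[OF eq, of a] by (auto simp: shift_up_def split: if_splits)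
  ultimately show "k = l \<and> A = B" by simp
qed

lemma inj_on_shift_down: "inj_on (case_prod shift_down) (shift_params n)"
proof (rule inj_onI, clarify)
  fix k l A B
  assume kA: "(k, A) \<in> shift_params n" and eq: "shift_down k A = shift_down l B"
  have "A = B" using eq by (metis ran_shift_down)
  moreover obtain a where "a \<in> A" using kA by (auto simp: mem_shift_params_iff)
  \<comment> \<open>\<open>a + k\<close> is the preimage of \<open>a\<close> under the first map,
    while the second map sends only \<open>a + l\<close> to \<open>a\<close>.\<close>
  then have "shift_down l B (a + k) = Some a"
    unfolding eq[symmetric] by (simp add: shift_down_eq_Some_iff)
  then have "k = l" by (simp add: shift_down_eq_Some_iff)
  ultimately show "k = l \<and> A = B" by simp
qed

text \<open>Equal distances fix differences up to sign and monotonicity fixes the sign, so the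
  displacement is constant. Conversely, a constant displacement gives injectivity as well as both
  conditions on pairs.\<close>

lemma mem_ODP_iff:
  "\<alpha> \<in> ODP n \<longleftrightarrow>
     (\<forall>x y. \<alpha> x = Some y \<longrightarrow> x \<in> {1..n} \<and> y \<in> {1..n}) \<and>
     (\<forall>x y u v. \<alpha> x = Some u \<longrightarrow> \<alpha> y = Some v \<longrightarrow> int u - int x = int v - int y)"
    (is "_ \<longleftrightarrow> ?bounds \<and> ?translation")
proof
  assume \<alpha>: "\<alpha> \<in> ODP n"
  have ?bounds
    using \<alpha> unfolding ODP_def partial_injections_def by (blast intro: domI ranI)
  moreover have ?translation
  proof (intro allI impI)
    fix x y u v assume "\<alpha> x = Some u" "\<alpha> y = Some v"
    then have "x \<in> dom \<alpha>" "y \<in> dom \<alpha>" "the (\<alpha> x) = u" "the (\<alpha> y) = v" by auto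
    \<comment> \<open>Monotonicity is taken in both directions because \<open>x\<close> and
      \<open>y\<close> come in no particular order.\<close>
    then have "\<bar>int x - int y\<bar> = \<bar>int u - int v\<bar>" "x \<le> y \<longrightarrow> u \<le> v" "y \<le> x \<longrightarrow> v \<le> u"
      using \<alpha> unfolding ODP_def by blast+
    then show "int u - int x = int v - int y" by linarith
  qed
  ultimately show "?bounds \<and> ?translation" ..
next
  assume asm: "?bounds \<and> ?translation"
  have "dom \<alpha> \<subseteq> {1..n}" "ran \<alpha> \<subseteq> {1..n}"
    using asm by (auto simp: dom_def ran_def)
  moreover have "inj_on \<alpha> (dom \<alpha>)"
  proof (rule inj_onI)
    fix x y assume "x \<in> dom \<alpha>" "y \<in> dom \<alpha>" "\<alpha> x = \<alpha> y"
    then obtain u where "\<alpha> x = Some u" "\<alpha> y = Some u" by auto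
    then have "int u - int x = int u - int y" using asm by blast
    then show "x = y" by simp
  qed
  moreover have "\<bar>int x - int y\<bar> = \<bar>int (the (\<alpha> x)) - int (the (\<alpha> y))\<bar> \<and>
      (x \<le> y \<longrightarrow> the (\<alpha> x) \<le> the (\<alpha> y))" if xy: "x \<in> dom \<alpha>" "y \<in> dom \<alpha>" for x y
  proof -
    obtain u v where "\<alpha> x = Some u" "\<alpha> y = Some v" using xy by blast
    moreover from this have "int u - int x = int v - int y" using asm by blast
    ultimately show ?thesis by auto
  qed
  ultimately show "\<alpha> \<in> ODP n"
    unfolding ODP_def partial_injections_def by blast
qed

text \<open>\<open>card\<close> is also 0 on infinite sets, so the equivalence rests on the fixed
  points lying in the finite set \<open>{1..n}\<close>.\<close>

lemma num_fixed_points_eq_0_iff: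
  assumes "\<alpha> \<in> ODP n"
  shows "num_fixed_points \<alpha> = 0 \<longleftrightarrow> (\<forall>x. \<alpha> x \<noteq> Some x)"
proof -
  have "fixed_points \<alpha> \<subseteq> {1..n}"
    using assms by (auto simp: fixed_points_def ODP_def partial_injections_def)
  then have "finite (fixed_points \<alpha>)" by (rule finite_subset) simp
  then show ?thesis by (auto simp: num_fixed_points_def fixed_points_def)
qed

text \<open>A nonempty map in \<open>ODP n\<close> has one constant displacement. Without fixed
  points it is nonzero, and its sign decides between the two families.\<close>

lemma fixed_point_free_ODP_eq:
  "{\<alpha> \<in> ODP n. num_fixed_points \<alpha> = 0} =
     insert Map.empty
       (case_prod shift_up ` shift_params n \<union> case_prod shift_down ` shift_params n)"
    (is "?L = ?R")
proof
  show "?L \<subseteq> ?R"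
  proof
    fix \<alpha> assume "\<alpha> \<in> ?L"
    then have bounds: "\<And>x y. \<alpha> x = Some y \<Longrightarrow> x \<in> {1..n} \<and> y \<in> {1..n}"
      and trans: "\<And>x y u v. \<alpha> x = Some u \<Longrightarrow> \<alpha> y = Some v \<Longrightarrow> int u - int x = int v - int y"
      and free: "\<And>x. \<alpha> x \<noteq> Some x"
      using mem_ODP_iff[of \<alpha> n] num_fixed_points_eq_0_iff[of \<alpha> n] by blast+
    show "\<alpha> \<in> ?R"
    proof (cases "\<alpha> = Map.empty")
      case False
      \<comment> \<open>A single pair determines the displacement of the whole map.\<close>
      then obtain a b where ab: "\<alpha> a = Some b" by fastforce
      then have "a \<noteq> b" using free by blast
      then consider "a < b" | "b < a" by linarith
      then show ?thesis
      proof cases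
        case 1
        define k where "k = b - a"
        have shift: "y = x + k" if "\<alpha> x = Some y" for x y
          using trans[OF ab that] 1 unfolding k_def by linarith
        have "\<alpha> x = shift_up k (dom \<alpha>) x" for x
          using shift by (cases "\<alpha> x") (auto simp: shift_up_def dom_def)
        then have "\<alpha> = shift_up k (dom \<alpha>)" by blast
        moreover have "(k, dom \<alpha>) \<in> shift_params n"
          unfolding mem_shift_params_iff
        proof (intro conjI subsetI)
          show "1 \<le> k" "k \<le> n" using 1 bounds[OF ab] by (auto simp: k_def)
          show "dom \<alpha> \<noteq> {}" using ab by (auto simp: dom_def)
          fix z assume "z \<in> dom \<alpha>"
          then obtain x y where xy: "\<alpha> x = Some y" "z = x" by (auto simp: dom_def)
          then show "z \<in> {1..n - k}" using bounds[OF xy(1)] shift[OF xy(1)] by auto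
        qed
        ultimately show ?thesis by (metis UnI1 case_prod_conv image_eqI insertI2)
      next
        case 2
        define k where "k = a - b"
        have shift: "x = y + k" if "\<alpha> x = Some y" for x y
          using trans[OF ab that] 2 unfolding k_def by linarith
        have "\<alpha> x = shift_down k (ran \<alpha>) x" for x
        proof -
          \<comment> \<open>Comparing the two maps through their graphs avoids the truncated
            subtraction in \<open>shift_down\<close>.\<close>
          have "\<alpha> x = Some y \<longleftrightarrow> shift_down k (ran \<alpha>) x = Some y" for y
            using shift by (auto simp: shift_down_eq_Some_iff ran_def)
          then show ?thesis by (metis not_Some_eq)
        qed
        then have "\<alpha> = shift_down k (ran \<alpha>)" by blast
        moreover have "(k, ran \<alpha>) \<in> shift_params n"
          unfolding mem_shift_params_iff
        proof (intro conjI subsetI)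
          show "1 \<le> k" "k \<le> n" using 2 bounds[OF ab] by (auto simp: k_def)
          show "ran \<alpha> \<noteq> {}" using ab by (auto simp: ran_def)
          fix z assume "z \<in> ran \<alpha>"
          then obtain x y where xy: "\<alpha> x = Some y" "z = y" by (auto simp: ran_def)
          then show "z \<in> {1..n - k}" using bounds[OF xy(1)] shift[OF xy(1)] by auto
        qed
        ultimately show ?thesis by (metis UnI2 case_prod_conv image_eqI insertI2)
      qed
    qed simp
  qed
next
  have fixed_point_free: "\<alpha> \<in> ODP n \<and> (\<forall>x. \<alpha> x \<noteq> Some x)" if "\<alpha> \<in> ?R" for \<alpha>
  proof -
    have "Map.empty \<in> ODP n" by (simp add: mem_ODP_iff)
    moreover have "shift_up k A \<in> ODP n \<and> (\<forall>x. shift_up k A x \<noteq> Some x)"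
      and "shift_down k A \<in> ODP n \<and> (\<forall>x. shift_down k A x \<noteq> Some x)"
      if kA: "(k, A) \<in> shift_params n" for k A
    proof -
      have k: "1 \<le> k" using kA by (simp add: mem_shift_params_iff)
      have "A \<subseteq> {1..n - k}" using kA by (simp add: mem_shift_params_iff)
      \<comment> \<open>From 1 \<le> x \<le> n - k the subtraction is not truncated, hence x + k
        \<le> n. This bounds domain and range of both shifts at once.\<close>
      then have A: "x \<in> {1..n} \<and> x + k \<in> {1..n}" if "x \<in> A" for x
        using that by fastforce
      show "shift_up k A \<in> ODP n \<and> (\<forall>x. shift_up k A x \<noteq> Some x)"
        using k A unfolding mem_ODP_iff shift_up_eq_Some_iff by auto
      show "shift_down k A \<in> ODP n \<and> (\<forall>x. shift_down k A x \<noteq> Some x)"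
        using k A unfolding mem_ODP_iff shift_down_eq_Some_iff by auto
    qed
    ultimately show ?thesis using that by auto
  qed
  show "?R \<subseteq> ?L"
  proof (intro subsetI CollectI conjI)
    fix \<alpha> assume \<alpha>: "\<alpha> \<in> ?R"
    show "\<alpha> \<in> ODP n" by (rule fixed_point_free[OF \<alpha>, THEN conjunct1])
    then show "num_fixed_points \<alpha> = 0"
      using fixed_point_free[OF \<alpha>] num_fixed_points_eq_0_iff[of \<alpha> n] by simp
  qed
qed

theorem proposition3p8:
  fixes n :: nat
  shows "int (card {\<alpha> \<in> ODP n. num_fixed_points \<alpha> = 0}) = 2 ^ (n + 1) - (2 * int n + 1)"
proof -
  let ?U = "case_prod shift_up ` shift_params n" and ?D = "case_prod shift_down ` shift_params n"
  \<comment> \<open>The strict direction of movement separates the two families; the existence of a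
    pair is needed for that, and it also excludes the empty map.\<close>
  have up: "(\<exists>x y. \<alpha> x = Some y) \<and> (\<forall>x y. \<alpha> x = Some y \<longrightarrow> x < y)" if "\<alpha> \<in> ?U" for \<alpha>
    using that by (auto simp: shift_up_eq_Some_iff mem_shift_params_iff)
  have down: "(\<exists>x y. \<alpha> x = Some y) \<and> (\<forall>x y. \<alpha> x = Some y \<longrightarrow> y < x)" if "\<alpha> \<in> ?D" for \<alpha>
    using that by (auto simp: shift_down_eq_Some_iff mem_shift_params_iff)
  have "?U \<inter> ?D = {}"
  proof (rule equals0I)
    fix \<alpha> assume "\<alpha> \<in> ?U \<inter> ?D"
    then have U: "\<alpha> \<in> ?U" and D: "\<alpha> \<in> ?D" by blast+
    obtain x y where xy: "\<alpha> x = Some y" using up[OF U] by blast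
    then have "x < y" "y < x" using up[OF U] down[OF D] by blast+
    then show False by simp
  qed
  moreover have "Map.empty \<notin> ?U \<union> ?D" using up[of Map.empty] down[of Map.empty] by blast
  ultimately have "card (insert Map.empty (?U \<union> ?D)) = Suc (card ?U + card ?D)"
    by (simp add: finite_shift_params card_Un_disjoint)
  \<comment> \<open>The count is 1 + 2 * (2 ^ n - 1 - n), the 1 coming from the empty map.\<close>
  then show ?thesis
    using card_shift_params[of n] unfolding fixed_point_free_ODP_eq
    by (simp add: card_image inj_on_shift_up inj_on_shift_down)
qed

end
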